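(* For every non-empty subset $J\subseteq\{1,\ldots,n\}$ and every $m$ with $0\le m\le N$, $$\widetilde{\mathcal H}_TH_m(x_J;a_J,|a|+b-a_J,N)=m(m+|a|+b-1)\,H_m(x_J;a_J,|a|+b-a_J,N),$$ where $x_J=\sum_{j\in J}x_j$ and $a_J=\sum_{j\in J}a_j$. Thus, for each degree $1\le m\le N$, there are at least $2^n-1$ eigenpolynomials of degree $m$ of $\widetilde{\mathcal H}_T$ with the same eigenvalue $m(m+|a|+b-1)$. Those of different degrees are orthogonal to each other: for $m\ne m'$ and all non-empty $J,J'$, $$\bigl(H_m(x_J;a_J,|a|+b-a_J,N),\,H_{m'}(x_{J'};a_{J'},|a|+b-a_{J'},N)\bigr)=0,$$ but those of the same degree, for different subsets $J$, are not orthogonal in general.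
   Context: Fix integers $N>n\ge2$ and real parameters $a_1,\ldots,a_n>0$, $b>0$; $|a|=\sum_{i=1}^na_i$. For $\boldsymbol x=(x_1,\ldots,x_n)$, $|x|=\sum_{i=1}^nx_i$; $\mathcal X=\{\boldsymbol x\in\mathbb N_0^n:|x|\le N\}$; $\boldsymbol e_j$ is the $j$-th unit vector; $(c)_k=c(c+1)\cdots(c+k-1)$, $(c)_0=1$. The operator $\widetilde{\mathcal H}_T$ acts on polynomials by $$\widetilde{\mathcal H}_T p(\boldsymbol x)=\sum_{j=1}^n(N-|x|)(x_j+a_j)\bigl(p(\boldsymbol x)-p(\boldsymbol x+\boldsymbol e_j)\bigr)+\sum_{j=1}^nx_j(N-|x|+b)\bigl(p(\boldsymbol x)-p(\boldsymbol x-\boldsymbol e_j)\bigr)+\sum_{1\le j\ne k\le n}x_j(x_k+a_k)\bigl(p(\boldsymbol x)-p(\boldsymbol x-\boldsymbol e_j+\boldsymbol e_k)\bigr).$$ Single variable Hahn polynomial: $H_m(x;a,b,N)=\sum_{k=0}^m\frac{(-m)_k(m+a+b-1)_k(-x)_k}{(a)_k(-N)_k\,k!}$, $0\le m\le N$. Inner product: $(p,q)=\sum_{\boldsymbol x\in\mathcal X}p(\boldsymbol x)q(\boldsymbol x)W(\boldsymbol x)$ with $$W(\boldsymbol x)=\frac{N!}{x_1!\cdots x_n!\,(N-|x|)!}\,\frac{\prod_{i=1}^n(a_i)_{x_i}\,(b)_{N-|x|}}{(|a|+b)_N}.$$ *)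

theory Defs
  imports "HOL-Analysis.Analysis"
begin

text \<open>
  The number of variables \<open>n\<close> is \<open>CARD('n)\<close>, so subsets of \<open>{1, \<dots>, n}\<close> are sets of type
  \<open>'n set\<close>. Polynomials in \<open>n\<close> variables are represented by the functions they induce on
  \<open>real ^ 'n\<close>, which loses nothing over the reals. The rising factorial \<open>(c)\<^sub>k\<close> is
  \<^term>\<open>pochhammer c k\<close>.
\<close>

definition subset_sum :: "'n::finite set \<Rightarrow> real ^ 'n \<Rightarrow> real" where
  "subset_sum J x = (\<Sum>j\<in>J. x $ j)"

abbreviation coord_sum :: "real ^ 'n::finite \<Rightarrow> real" where
  "coord_sum x \<equiv> subset_sum UNIV x"

definition H_op ::
  "nat \<Rightarrow> real ^ 'n::finite \<Rightarrow> real \<Rightarrow> (real ^ 'n \<Rightarrow> real) \<Rightarrow> real ^ 'n \<Rightarrow> real" where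
  "H_op N a b p x =
     (\<Sum>j\<in>UNIV. (real N - coord_sum x) * (x $ j + a $ j) * (p x - p (x + axis j 1)))
   + (\<Sum>j\<in>UNIV. x $ j * (real N - coord_sum x + b) * (p x - p (x - axis j 1)))
   + (\<Sum>j\<in>UNIV. \<Sum>k\<in>UNIV - {j}.
        x $ j * (x $ k + a $ k) * (p x - p (x - axis j 1 + axis k 1)))"

definition hahn :: "nat \<Rightarrow> real \<Rightarrow> real \<Rightarrow> real \<Rightarrow> nat \<Rightarrow> real" where
  "hahn m x a b N =
     (\<Sum>k=0..m. pochhammer (- real m) k * pochhammer (real m + a + b - 1) k * pochhammer (- x) k
        / (pochhammer a k * pochhammer (- real N) k * fact k))"

definition hahn_subset ::
  "nat \<Rightarrow> real ^ 'n::finite \<Rightarrow> real \<Rightarrow> nat \<Rightarrow> 'n set \<Rightarrow> real ^ 'n \<Rightarrow> real" where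
  "hahn_subset N a b m J x =
     hahn m (subset_sum J x) (subset_sum J a) (coord_sum a + b - subset_sum J a) N"

definition simplex_points :: "nat \<Rightarrow> (nat ^ 'n::finite) set" where
  "simplex_points N = {x. (\<Sum>i\<in>UNIV. x $ i) \<le> N}"

definition weight :: "nat \<Rightarrow> real ^ 'n::finite \<Rightarrow> real \<Rightarrow> nat ^ 'n \<Rightarrow> real" where
  "weight N a b x =
     fact N / ((\<Prod>i\<in>UNIV. fact (x $ i)) * fact (N - (\<Sum>i\<in>UNIV. x $ i)))
   * ((\<Prod>i\<in>UNIV. pochhammer (a $ i) (x $ i)) * pochhammer b (N - (\<Sum>i\<in>UNIV. x $ i))
      / pochhammer (coord_sum a + b) N)"

definition inner_W ::
  "nat \<Rightarrow> real ^ 'n::finite \<Rightarrow> real \<Rightarrow> (real ^ 'n \<Rightarrow> real) \<Rightarrow> (real ^ 'n \<Rightarrow> real) \<Rightarrow> real" where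
  "inner_W N a b p q =
     (\<Sum>x\<in>simplex_points N. p (\<chi> i. real (x $ i)) * q (\<chi> i. real (x $ i)) * weight N a b x)"

text \<open>
  Total degree exactly \<open>m\<close>; in particular the polynomial is nonzero. The coefficient family \<open>c\<close>
  is indexed by exponent vectors and is uniquely determined by \<open>p\<close>.
\<close>

definition polynomial_of_degree :: "nat \<Rightarrow> (real ^ 'n::finite \<Rightarrow> real) \<Rightarrow> bool" where
  "polynomial_of_degree m p \<longleftrightarrow>
     (\<exists>c :: nat ^ 'n \<Rightarrow> real.
        finite {\<alpha>. c \<alpha> \<noteq> 0}
      \<and> p = (\<lambda>x. \<Sum>\<alpha>\<in>{\<alpha>. c \<alpha> \<noteq> 0}. c \<alpha> * (\<Prod>i\<in>UNIV. (x $ i) ^ (\<alpha> $ i)))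
      \<and> (\<forall>\<alpha>. c \<alpha> \<noteq> 0 \<longrightarrow> (\<Sum>i\<in>UNIV. \<alpha> $ i) \<le> m)
      \<and> (\<exists>\<alpha>. c \<alpha> \<noteq> 0 \<and> (\<Sum>i\<in>UNIV. \<alpha> $ i) = m))"

definition eigenpolynomial ::
  "nat \<Rightarrow> real ^ 'n::finite \<Rightarrow> real \<Rightarrow> nat \<Rightarrow> real \<Rightarrow> (real ^ 'n \<Rightarrow> real) \<Rightarrow> bool" where
  "eigenpolynomial N a b m ev p \<longleftrightarrow>
     polynomial_of_degree m p \<and> (\<forall>x. H_op N a b p x = ev * p x)"

end

theory Submission
  imports Defs
begin

text \<open>
  On a function \<open>f (x\<^sub>J)\<close> of one partial sum the operator acts as the univariate Hahn difference
  operator with parameters \<open>a\<^sub>J\<close> and \<open>|a| + b - a\<^sub>J\<close>: only moves across the boundary of \<open>J\<close> change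
  \<open>x\<^sub>J\<close>, and their rates, summed over all such moves, depend on \<open>x\<^sub>J\<close> alone (\<open>H_op_subset_sum\<close>).
  The eigenvalue equation is then the classical difference equation of the Hahn polynomials
  (\<open>hahn_difference_equation\<close>), which holds because in the basis \<open>(-t)\<^sub>k\<close> the Hahn operator is
  bidiagonal. The sum of the two parameters is \<open>|a| + b\<close> for every \<open>J\<close>, whence the common
  eigenvalue.

  Restricting to the coordinate axis of some \<open>j \<in> J\<close> turns the polynomial of \<open>J\<close> into a Hahn
  polynomial of exact degree \<open>m\<close>. This gives the total degree, and it separates different
  subsets: along an axis outside \<open>J\<close> the polynomial of \<open>J\<close> is constant. As every one of these
  polynomials has the value 1 at the origin, proportional ones are equal.

  Orthogonality in different degrees is self-adjointness. The weight satisfies a detailed balance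
  condition (\<open>detailed_balance\<close>), which writes \<open>(H p, q)\<close> as a Dirichlet form, a sum of products
  of differences of \<open>p\<close> and of \<open>q\<close> (\<open>inner_W_H_op\<close>); this is symmetric in \<open>p\<close> and \<open>q\<close>, and the
  eigenvalues \<open>m (m + |a| + b - 1)\<close> are distinct.

  For the failure of orthogonality in equal degree, compare an arbitrary \<open>J\<close> with the full index
  set. Self-adjointness and the three-term form of the Hahn operator in \<open>|x|\<close> show that
  the masses \<open>\<Sum> p W\<close> over the levels \<open>|x| = s\<close> of an eigenfunction \<open>p\<close> satisfy a
  recurrence that determines them from \<open>p 0\<close> and the eigenvalue
  (\<open>eigenfunctions_agree_on_levels\<close>). So the polynomial of \<open>J\<close> and that of the full set have the
  same inner product with every function of \<open>|x|\<close>, in particular with the latter polynomial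
  itself, and the common value is a positive squared norm. (In other words, the conditional
  expectation of the polynomial of \<open>J\<close> given \<open>|x|\<close> is the polynomial of the full set.)
\<close>

section \<open>The univariate Hahn difference equation\<close>

definition hahn_op :: "real \<Rightarrow> real \<Rightarrow> real \<Rightarrow> (real \<Rightarrow> real) \<Rightarrow> real \<Rightarrow> real" where
  "hahn_op N \<alpha> \<beta> f t =
     (N - t) * (t + \<alpha>) * (f t - f (t + 1)) + t * (N - t + \<beta>) * (f t - f (t - 1))"

definition hahn_coeff :: "nat \<Rightarrow> real \<Rightarrow> real \<Rightarrow> nat \<Rightarrow> nat \<Rightarrow> real" where
  "hahn_coeff m \<alpha> \<beta> N k =
     pochhammer (- real m) k * pochhammer (real m + \<alpha> + \<beta> - 1) k
       / (pochhammer \<alpha> k * pochhammer (- real N) k * fact k)"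

lemma hahn_eq_sum_coeff:
  "hahn m t \<alpha> \<beta> N = (\<Sum>k\<le>m. hahn_coeff m \<alpha> \<beta> N k * pochhammer (- t) k)"
  unfolding hahn_def hahn_coeff_def by (simp add: atMost_atLeast0)

lemma pochhammer_minus_forward_difference:
  "pochhammer (- t) (Suc k) - pochhammer (- (t + 1)) (Suc k)
     = (1 + real k) * pochhammer (- t :: real) k"
proof -
  have "pochhammer (- (t + 1)) (Suc k) = (- t - 1) * pochhammer (- t) k"
    by (simp add: pochhammer_rec)
  then show ?thesis
    by (simp add: pochhammer_Suc algebra_simps)
qed

lemma pochhammer_minus_backward_difference:
  "t * (pochhammer (- t) (Suc k) - pochhammer (- (t - 1)) (Suc k))
     = (1 + real k) * pochhammer (- t :: real) (Suc k)"
proof -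
  have "pochhammer (- t) (Suc k) = - t * pochhammer (1 - t) k"
    by (simp add: pochhammer_rec)
  moreover have "pochhammer (- (t - 1)) (Suc k) = pochhammer (1 - t) k * (1 - t + real k)"
    by (simp add: pochhammer_Suc)
  ultimately show ?thesis
    by (simp only:) (simp add: algebra_simps)
qed

text \<open>
  The basis \<open>(-t)\<^sub>k\<close> is adapted to differences as powers are to derivatives: the forward difference
  lowers the index by one, and \<open>t\<close> times the backward difference keeps it. The quadratic
  terms in \<open>t\<close> cancel after rewriting \<open>t (-t)\<^sub>k\<close> as \<open>k (-t)\<^sub>k - (-t)\<^sub>k\<^sub>+\<^sub>1\<close>, so the Hahn operator is
  bidiagonal in this basis.
\<close>

lemma hahn_op_pochhammer_Suc:
  "hahn_op N \<alpha> \<beta> (\<lambda>t. pochhammer (- t) (Suc k)) t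
     = (1 + real k) * (real k + \<alpha> + \<beta>) * pochhammer (- t) (Suc k)
       + (1 + real k) * (real k + \<alpha>) * (N - real k) * pochhammer (- t) k"
proof -
  have "hahn_op N \<alpha> \<beta> (\<lambda>t. pochhammer (- t) (Suc k)) t
      = (N - t) * (t + \<alpha>) * ((1 + real k) * pochhammer (- t) k)
        + (N - t + \<beta>) * ((1 + real k) * pochhammer (- t) (Suc k))"
    unfolding hahn_op_def pochhammer_minus_forward_difference
      pochhammer_minus_backward_difference[symmetric] by simp
  also have "\<dots> = (1 + real k) * (real k + \<alpha> + \<beta>) * pochhammer (- t) (Suc k)
      + (1 + real k) * (real k + \<alpha>) * (N - real k) * pochhammer (- t) k"
    by (simp add: pochhammer_Suc algebra_simps)
  finally show ?thesis .
qed

lemma hahn_op_sum: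
  "hahn_op N \<alpha> \<beta> (\<lambda>t. \<Sum>k\<in>K. c k * f k t) t = (\<Sum>k\<in>K. c k * hahn_op N \<alpha> \<beta> (f k) t)"
  unfolding hahn_op_def
  by (simp add: sum_subtractf[symmetric] sum_distrib_left sum.distrib[symmetric] algebra_simps)

text \<open>
  This recurrence says that the coefficients form an eigenvector of the bidiagonal matrix of the
  Hahn operator: what flows down from index \<open>k + 1\<close> makes up for the eigenvalue gap at \<open>k\<close>.
  The assumption \<open>k < N\<close> keeps \<open>(-N)\<^sub>k\<^sub>+\<^sub>1\<close> away from zero.
\<close>

lemma hahn_coeff_Suc:
  assumes "k < N" "\<alpha> > 0"
  shows "hahn_coeff m \<alpha> \<beta> N (Suc k) * ((1 + real k) * (real k + \<alpha>) * (real N - real k))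
    = hahn_coeff m \<alpha> \<beta> N k
        * (real m * (real m + \<alpha> + \<beta> - 1) - real k * (real k + \<alpha> + \<beta> - 1))"
proof -
  define d where "d = (\<alpha> + real k) * (real k - real N) * (1 + real k)"
  have "d \<noteq> 0"
    using assms by (simp add: d_def)
  have "hahn_coeff m \<alpha> \<beta> N (Suc k)
      = hahn_coeff m \<alpha> \<beta> N k * ((real k - real m) * (real m + \<alpha> + \<beta> - 1 + real k) / d)"
    by (simp add: hahn_coeff_def d_def pochhammer_Suc mult_ac)
  then have "hahn_coeff m \<alpha> \<beta> N (Suc k) * d
      = hahn_coeff m \<alpha> \<beta> N k * ((real k - real m) * (real m + \<alpha> + \<beta> - 1 + real k))"
    using \<open>d \<noteq> 0\<close> by simp
  then show ?thesis
    unfolding d_def by algebra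
qed

theorem hahn_difference_equation:
  assumes "m \<le> N" "\<alpha> > 0"
  shows "hahn_op (real N) \<alpha> \<beta> (\<lambda>t. hahn m t \<alpha> \<beta> N) t
    = real m * (real m + \<alpha> + \<beta> - 1) * hahn m t \<alpha> \<beta> N"
proof -
  define c where "c = hahn_coeff m \<alpha> \<beta> N"
  define \<phi> where "\<phi> k = pochhammer (- t) k" for k
  define ev where "ev k = real k * (real k + \<alpha> + \<beta> - 1)" for k
  define low where "low k = (1 + real k) * (real k + \<alpha>) * (real N - real k)" for k
  have step: "hahn_op (real N) \<alpha> \<beta> (\<lambda>t. pochhammer (- t) (Suc k)) t
      = ev (Suc k) * \<phi> (Suc k) + low k * \<phi> k" for k
    unfolding hahn_op_pochhammer_Suc ev_def low_def \<phi>_def by (simp add: algebra_simps)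
  have base: "hahn_op (real N) \<alpha> \<beta> (\<lambda>t. pochhammer (- t) 0) t = 0"
    by (simp add: hahn_op_def)
  have rec: "c (Suc k) * low k = c k * (ev m - ev k)" if "k < m" for k
    using hahn_coeff_Suc[of k N \<alpha> m \<beta>] that assms
    unfolding c_def low_def ev_def by simp
  have "hahn_op (real N) \<alpha> \<beta> (\<lambda>t. hahn m t \<alpha> \<beta> N) t
      = (\<Sum>k\<le>m. c k * hahn_op (real N) \<alpha> \<beta> (\<lambda>t. pochhammer (- t) k) t)"
    unfolding hahn_eq_sum_coeff c_def by (rule hahn_op_sum)
  also have "\<dots> = (\<Sum>k<m. c (Suc k) * ev (Suc k) * \<phi> (Suc k) + c k * (ev m - ev k) * \<phi> k)"
  proof -
    have "c (Suc k) * hahn_op (real N) \<alpha> \<beta> (\<lambda>t. pochhammer (- t) (Suc k)) t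
        = c (Suc k) * ev (Suc k) * \<phi> (Suc k) + c k * (ev m - ev k) * \<phi> k" if "k < m" for k
      unfolding step rec[OF that, symmetric] by (simp add: algebra_simps)
    then show ?thesis
      unfolding lessThan_Suc_atMost[symmetric] sum.lessThan_Suc_shift base by simp
  qed
  also have "\<dots> = (\<Sum>k\<le>m. c k * ev k * \<phi> k) + (\<Sum>k\<le>m. c k * (ev m - ev k) * \<phi> k)"
  proof -
    have "(\<Sum>k\<le>m. c k * ev k * \<phi> k) = (\<Sum>k<m. c (Suc k) * ev (Suc k) * \<phi> (Suc k))"
      by (simp add: lessThan_Suc_atMost[symmetric] sum.lessThan_Suc_shift ev_def
          del: sum.lessThan_Suc)
    moreover have "(\<Sum>k\<le>m. c k * (ev m - ev k) * \<phi> k) = (\<Sum>k<m. c k * (ev m - ev k) * \<phi> k)"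
      by (simp add: lessThan_Suc_atMost[symmetric])
    ultimately show ?thesis
      by (simp add: sum.distrib)
  qed
  also have "\<dots> = ev m * (\<Sum>k\<le>m. c k * \<phi> k)"
    by (simp add: sum.distrib[symmetric] sum_distrib_left algebra_simps)
  finally show ?thesis
    unfolding hahn_eq_sum_coeff c_def \<phi>_def ev_def .
qed

lemma degree_pochhammer_minus_X: "degree (pochhammer [:0, - 1 :: real:] k) = k"
proof (induction k)
  case (Suc k)
  have lin: "[:0, - 1:] + of_nat k = [:real k, - 1 :: real:]"
    by (simp add: of_nat_poly)
  have "pochhammer [:0, - 1 :: real:] k \<noteq> 0"
    using Suc by (cases k) auto
  then show ?case
    unfolding pochhammer_Suc lin by (subst degree_mult_eq) (auto simp: Suc)
qed simp

lemma poly_pochhammer: "poly (pochhammer p k) t = pochhammer (poly p t :: real) k"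
  by (simp add: pochhammer_prod poly_prod)

text \<open>
  The degree does not drop: the factor \<open>(m + \<alpha> + \<beta> - 1)\<^sub>m\<close> of the leading coefficient is
  nonzero because \<open>\<alpha> + \<beta> > 0\<close>, and \<open>(-m)\<^sub>m\<close> is nonzero.
\<close>

lemma hahn_poly_exists:
  assumes "m \<le> N" "\<alpha> > 0" "\<alpha> + \<beta> > 0"
  obtains Q where "degree Q = m" "\<And>t. poly Q t = hahn m t \<alpha> \<beta> N"
proof -
  define c where "c = hahn_coeff m \<alpha> \<beta> N"
  define Q where "Q = (\<Sum>k\<le>m. smult (c k) (pochhammer [:0, - 1:] k))"
  have "pochhammer (real m + \<alpha> + \<beta> - 1) m \<noteq> 0"
    using assms by (auto simp: pochhammer_eq_0_iff)
  then have "c m \<noteq> 0"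
    using assms by (auto simp: c_def hahn_coeff_def pochhammer_eq_0_iff)
  moreover have "pochhammer [:0, - 1 :: real:] m \<noteq> 0"
    using degree_pochhammer_minus_X[of m] by (cases m) auto
  ultimately have "coeff Q m \<noteq> 0"
    using degree_pochhammer_minus_X[of m]
    by (simp add: Q_def coeff_sum lessThan_Suc_atMost[symmetric] coeff_eq_0
        degree_pochhammer_minus_X leading_coeff_0_iff[symmetric] del: leading_coeff_0_iff)
  moreover have "degree Q \<le> m"
    unfolding Q_def
    by (rule degree_sum_le) (auto simp: degree_pochhammer_minus_X intro: order.trans[OF degree_smult_le])
  ultimately have "degree Q = m"
    by (simp add: le_antisym le_degree)
  moreover have "poly Q t = hahn m t \<alpha> \<beta> N" for t
    by (simp add: Q_def poly_sum poly_pochhammer hahn_eq_sum_coeff c_def)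
  ultimately show ?thesis by (rule that)
qed

lemma hahn_0 [simp]: "hahn m 0 \<alpha> \<beta> N = 1"
  unfolding hahn_def
  by (subst sum.atLeast_Suc_atMost) (auto simp: pochhammer_0_left intro!: sum.neutral)

lemma hahn_not_constant:
  assumes "1 \<le> m" "m \<le> N" "\<alpha> > 0" "\<alpha> + \<beta> > 0"
  shows "\<exists>t. hahn m t \<alpha> \<beta> N \<noteq> 1"
proof (rule ccontr)
  assume "\<not> ?thesis"
  then have const: "hahn m t \<alpha> \<beta> N = poly 1 t" for t by simp
  obtain Q where "degree Q = m" "\<And>t. poly Q t = hahn m t \<alpha> \<beta> N"
    using hahn_poly_exists assms by metis
  then have "degree Q = m" "Q = 1"
    using const by (auto simp: poly_eq_poly_eq_iff[symmetric])
  then show False using assms by simp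
qed

section \<open>Functions of a partial sum of the coordinates\<close>

lemma subset_sum_add [simp]: "subset_sum J (x + y) = subset_sum J x + subset_sum J y"
  by (simp add: subset_sum_def sum.distrib)

lemma subset_sum_diff [simp]: "subset_sum J (x - y) = subset_sum J x - subset_sum J y"
  by (simp add: subset_sum_def sum_subtractf)

lemma subset_sum_axis [simp]: "subset_sum J (axis j t) = (if j \<in> J then t else 0)"
  by (simp add: subset_sum_def axis_def)

lemma subset_sum_0 [simp]: "subset_sum J 0 = 0"
  by (simp add: subset_sum_def)

lemma subset_sum_pos:
  assumes "J \<noteq> {}" "\<And>i. a $ i > 0"
  shows "subset_sum J a > 0"
  unfolding subset_sum_def using assms by (intro sum_pos) auto

lemma sum_over_subset:
  fixes x :: "real ^ 'n::finite"
  shows "(\<Sum>j\<in>UNIV. x $ j * of_bool (j \<in> J)) = subset_sum J x"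
    "(\<Sum>j\<in>UNIV. x $ j * of_bool (j \<notin> J)) = coord_sum x - subset_sum J x"
proof -
  show "(\<Sum>j\<in>UNIV. x $ j * of_bool (j \<in> J)) = subset_sum J x"
    unfolding subset_sum_def by (intro sum.mono_neutral_cong_right) auto
  then show "(\<Sum>j\<in>UNIV. x $ j * of_bool (j \<notin> J)) = coord_sum x - subset_sum J x"
    by (simp add: of_bool_not_iff right_diff_distrib sum_subtractf)
       (simp add: subset_sum_def)
qed

text \<open>
  Moves that stay inside \<open>J\<close> or outside \<open>J\<close> leave \<open>x\<^sub>J\<close> unchanged. The coordinates outside \<open>J\<close>
  together with the reservoir \<open>N - |x|\<close> hold \<open>N - x\<^sub>J\<close>, so the total rate of \<open>x\<^sub>J \<rightarrow> x\<^sub>J + 1\<close> is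
  \<open>(N - x\<^sub>J) (x\<^sub>J + a\<^sub>J)\<close>, and that of \<open>x\<^sub>J \<rightarrow> x\<^sub>J - 1\<close> is \<open>x\<^sub>J (N - x\<^sub>J + |a| + b - a\<^sub>J)\<close>.
\<close>

lemma H_op_subset_sum:
  fixes a x :: "real ^ 'n::finite"
  shows "H_op N a b (\<lambda>x. f (subset_sum J x)) x
    = hahn_op (real N) (subset_sum J a) (coord_sum a + b - subset_sum J a) f (subset_sum J x)"
proof -
  define s X where "s = subset_sum J x" and "X = coord_sum x"
  define \<alpha> A where "\<alpha> = subset_sum J a" and "A = coord_sum a"
  define up where "up = f s - f (s + 1)"
  define down where "down = f s - f (s - 1)"
  define y where "y = x + a"
  have y: "x $ k + a $ k = y $ k" for k
    by (simp add: y_def)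
  have first: "(\<Sum>j\<in>UNIV. (real N - X) * y $ j * (f s - f (subset_sum J (x + axis j 1))))
      = (real N - X) * (s + \<alpha>) * up"
  proof -
    have "(\<Sum>j\<in>UNIV. (real N - X) * y $ j * (f s - f (subset_sum J (x + axis j 1))))
        = (\<Sum>j\<in>UNIV. (real N - X) * up * (y $ j * of_bool (j \<in> J)))"
      by (rule sum.cong) (auto simp: s_def up_def)
    then show ?thesis
      by (simp add: sum_distrib_left[symmetric] sum_over_subset) (simp add: y_def s_def \<alpha>_def)
  qed
  have second: "(\<Sum>j\<in>UNIV. x $ j * (real N - X + b) * (f s - f (subset_sum J (x - axis j 1))))
      = s * (real N - X + b) * down"
  proof -
    have "(\<Sum>j\<in>UNIV. x $ j * (real N - X + b) * (f s - f (subset_sum J (x - axis j 1))))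
        = (\<Sum>j\<in>UNIV. (real N - X + b) * down * (x $ j * of_bool (j \<in> J)))"
      by (rule sum.cong) (auto simp: s_def down_def)
    then show ?thesis
      by (simp add: sum_distrib_left[symmetric] sum_over_subset s_def)
  qed
  have third: "(\<Sum>j\<in>UNIV. \<Sum>k\<in>UNIV - {j}. x $ j * y $ k
        * (f s - f (subset_sum J (x - axis j 1 + axis k 1))))
      = s * (X - s + A - \<alpha>) * down + (X - s) * (s + \<alpha>) * up"
  proof -
    have "(\<Sum>k\<in>UNIV - {j}. x $ j * y $ k * (f s - f (subset_sum J (x - axis j 1 + axis k 1))))
        = (\<Sum>k\<in>UNIV. down * (x $ j * of_bool (j \<in> J)) * (y $ k * of_bool (k \<notin> J))
            + up * (x $ j * of_bool (j \<notin> J)) * (y $ k * of_bool (k \<in> J)))" for j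
      by (rule sum.mono_neutral_cong_left) (auto simp: s_def up_def down_def)
    then show ?thesis
      by (simp add: sum.distrib sum_distrib_left[symmetric] sum_distrib_right[symmetric]
          sum_over_subset)
         (simp add: y_def s_def X_def A_def \<alpha>_def algebra_simps)
  qed
  show ?thesis
    unfolding H_op_def hahn_op_def y s_def[symmetric] X_def[symmetric] \<alpha>_def[symmetric]
      A_def[symmetric] first second third up_def[symmetric] down_def[symmetric]
    by (simp add: algebra_simps)
qed

theorem H_op_hahn_subset:
  fixes a x :: "real ^ 'n::finite"
  assumes "J \<noteq> {}" "m \<le> N" "\<And>i. a $ i > 0"
  shows "H_op N a b (hahn_subset N a b m J) x
    = real m * (real m + coord_sum a + b - 1) * hahn_subset N a b m J x"
proof -
  have *: "hahn_subset N a b m J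
      = (\<lambda>x. hahn m (subset_sum J x) (subset_sum J a) (coord_sum a + b - subset_sum J a) N)"
    by (rule ext) (simp add: hahn_subset_def)
  have "subset_sum J a > 0"
    using assms by (intro subset_sum_pos) auto
  from hahn_difference_equation[OF assms(2) this] show ?thesis
    unfolding * H_op_subset_sum
      [of N a b "\<lambda>t. hahn m t (subset_sum J a) (coord_sum a + b - subset_sum J a) N"]
    by (simp add: algebra_simps)
qed

section \<open>Lattice points of the simplex\<close>

abbreviation total :: "nat ^ 'n::finite \<Rightarrow> nat" where
  "total z \<equiv> \<Sum>i\<in>UNIV. z $ i"

abbreviation real_point :: "nat ^ 'n::finite \<Rightarrow> real ^ 'n" where
  "real_point z \<equiv> \<chi> i. real (z $ i)"

lemma mem_simplex_points: "z \<in> simplex_points N \<longleftrightarrow> total z \<le> N"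
  by (simp add: simplex_points_def)

lemma finite_simplex_points: "finite (simplex_points N :: (nat ^ 'n::finite) set)"
proof -
  have "z $ i \<le> N" if "total z \<le> N" for z :: "nat ^ 'n" and i
    using member_le_sum[of i UNIV "($) z"] that by simp
  then have "vec_nth ` (simplex_points N :: (nat ^ 'n) set) \<subseteq> (\<Pi>\<^sub>E i\<in>UNIV. {..N})"
    by (auto simp: mem_simplex_points)
  then have "finite (vec_nth ` (simplex_points N :: (nat ^ 'n) set))"
    by (rule finite_subset) (auto intro: finite_PiE)
  then show ?thesis
    by (rule finite_imageD) (simp add: inj_on_def vec_eq_iff)
qed

lemma total_add_axis [simp]: "total (z + axis j 1) = Suc (total z)"
  by (simp add: sum.distrib axis_def)

lemma real_point_add_axis: "real_point (z + axis j 1) = real_point z + axis j 1"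
  by (simp add: vec_eq_iff axis_def)

lemma coord_sum_real_point: "coord_sum (real_point z) = real (total z)"
  by (simp add: subset_sum_def)

text \<open>
  Both the multiplication of polynomials by a coordinate and the change of variables in
  the Dirichlet form rest on this reindexing.
\<close>

lemma sum_simplex_points_shift:
  fixes G :: "nat ^ 'n::finite \<Rightarrow> 'b::comm_monoid_add"
  shows "(\<Sum>x\<in>{x \<in> simplex_points (Suc M). x $ j > 0}. G x)
    = (\<Sum>z\<in>simplex_points M. G (z + axis j 1))"
proof (rule sum.reindex_bij_witness[where i = "\<lambda>z. z + axis j 1" and j = "\<lambda>x. x - axis j 1"])
  fix x :: "nat ^ 'n"
  assume "x \<in> {x \<in> simplex_points (Suc M). x $ j > 0}"
  then have x: "total x \<le> Suc M" "x $ j > 0"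
    by (auto simp: mem_simplex_points)
  show restore: "x - axis j 1 + axis j 1 = x"
    using x(2) by (auto simp: vec_eq_iff axis_def)
  show "G (x - axis j 1 + axis j 1) = G x"
    by (simp only: restore)
  have "total x = Suc (total (x - axis j 1))"
    by (metis restore total_add_axis)
  then show "x - axis j 1 \<in> simplex_points M"
    using x(1) by (simp add: mem_simplex_points)
next
  fix z :: "nat ^ 'n"
  assume "z \<in> simplex_points M"
  then have "total (z + axis j 1) \<le> Suc M"
    unfolding total_add_axis by (simp add: mem_simplex_points)
  then show "z + axis j 1 \<in> {x \<in> simplex_points (Suc M). x $ j > 0}"
    by (simp add: mem_simplex_points del: vector_add_component) (simp add: axis_def)
  show "z + axis j 1 - axis j 1 = z"
    by (simp add: vec_eq_iff)
qed

section \<open>Degree and independence of the eigenpolynomials\<close>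

text \<open>
  Exponent vectors of total degree at most \<open>m\<close> are exactly the lattice points of the simplex of
  size \<open>m\<close>. Letting the coefficients range over this fixed finite set makes the closure properties
  plain identities between finite sums.
\<close>

definition poly_degree_le :: "nat \<Rightarrow> (real ^ 'n::finite \<Rightarrow> real) \<Rightarrow> bool" where
  "poly_degree_le m p \<longleftrightarrow>
     (\<exists>c. \<forall>x. p x = (\<Sum>\<alpha>\<in>simplex_points m. c \<alpha> * (\<Prod>i\<in>UNIV. (x $ i) ^ (\<alpha> $ i))))"

lemma poly_degree_le_const: "poly_degree_le m (\<lambda>x. r)"
  unfolding poly_degree_le_def
proof (intro exI allI)
  fix x :: "real ^ 'n"
  have "(\<Sum>\<alpha>\<in>simplex_points m. (if \<alpha> = 0 then r else 0) * (\<Prod>i\<in>UNIV. (x $ i) ^ (\<alpha> $ i)))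
      = (\<Sum>\<alpha>\<in>{0 :: nat ^ 'n}. r)"
    by (rule sum.mono_neutral_cong_right)
       (auto simp: finite_simplex_points mem_simplex_points)
  then show "r = (\<Sum>\<alpha>\<in>simplex_points m. (if \<alpha> = 0 then r else 0) * (\<Prod>i\<in>UNIV. (x $ i) ^ (\<alpha> $ i)))"
    by simp
qed

lemma poly_degree_le_add:
  assumes "poly_degree_le m p" "poly_degree_le m q"
  shows "poly_degree_le m (\<lambda>x. p x + q x)"
proof -
  from assms obtain c d where
    "\<And>x. p x = (\<Sum>\<alpha>\<in>simplex_points m. c \<alpha> * (\<Prod>i\<in>UNIV. (x $ i) ^ (\<alpha> $ i)))"
    "\<And>x. q x = (\<Sum>\<alpha>\<in>simplex_points m. d \<alpha> * (\<Prod>i\<in>UNIV. (x $ i) ^ (\<alpha> $ i)))"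
    unfolding poly_degree_le_def by blast
  then show ?thesis
    unfolding poly_degree_le_def
    by (intro exI[of _ "\<lambda>\<alpha>. c \<alpha> + d \<alpha>"]) (simp add: sum.distrib distrib_right)
qed

lemma poly_degree_le_scale:
  assumes "poly_degree_le m p"
  shows "poly_degree_le m (\<lambda>x. r * p x)"
proof -
  from assms obtain c where
    "\<And>x. p x = (\<Sum>\<alpha>\<in>simplex_points m. c \<alpha> * (\<Prod>i\<in>UNIV. (x $ i) ^ (\<alpha> $ i)))"
    unfolding poly_degree_le_def by blast
  then show ?thesis
    unfolding poly_degree_le_def
    by (intro exI[of _ "\<lambda>\<alpha>. r * c \<alpha>"]) (simp add: sum_distrib_left mult.assoc)
qed

lemma poly_degree_le_sum:
  assumes "\<And>k. k \<in> K \<Longrightarrow> poly_degree_le m (p k)"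
  shows "poly_degree_le m (\<lambda>x. \<Sum>k\<in>K. p k x)"
  using assms
  by (induction K rule: infinite_finite_induct)
     (auto intro: poly_degree_le_const poly_degree_le_add)

lemma poly_degree_le_mono:
  assumes "poly_degree_le k p" "k \<le> m"
  shows "poly_degree_le m p"
proof -
  from assms obtain c where
    c: "\<And>x. p x = (\<Sum>\<alpha>\<in>simplex_points k. c \<alpha> * (\<Prod>i\<in>UNIV. (x $ i) ^ (\<alpha> $ i)))"
    unfolding poly_degree_le_def by blast
  define d where "d \<alpha> = (if \<alpha> \<in> simplex_points k then c \<alpha> else 0)" for \<alpha>
  have "p x = (\<Sum>\<alpha>\<in>simplex_points m. d \<alpha> * (\<Prod>i\<in>UNIV. (x $ i) ^ (\<alpha> $ i)))" for x
    unfolding c d_def using assms(2)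
    by (intro sum.mono_neutral_cong_left) (auto simp: finite_simplex_points mem_simplex_points)
  then show ?thesis
    unfolding poly_degree_le_def by blast
qed

lemma poly_degree_le_mult_coord:
  fixes p :: "real ^ 'n::finite \<Rightarrow> real"
  assumes "poly_degree_le m p"
  shows "poly_degree_le (Suc m) (\<lambda>x. x $ j * p x)"
proof -
  from assms obtain c where
    c: "\<And>x. p x = (\<Sum>\<alpha>\<in>simplex_points m. c \<alpha> * (\<Prod>i\<in>UNIV. (x $ i) ^ (\<alpha> $ i)))"
    unfolding poly_degree_le_def by blast
  define c' where "c' \<beta> = (if \<beta> $ j > 0 then c (\<beta> - axis j 1) else 0)" for \<beta>
  have "x $ j * p x = (\<Sum>\<beta>\<in>simplex_points (Suc m). c' \<beta> * (\<Prod>i\<in>UNIV. (x $ i) ^ (\<beta> $ i)))" for x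
  proof -
    have monom: "(\<Prod>i\<in>UNIV. (x $ i) ^ ((\<alpha> + axis j 1) $ i))
        = x $ j * (\<Prod>i\<in>UNIV. (x $ i) ^ (\<alpha> $ i))" for \<alpha>
    proof -
      have "(\<Prod>i\<in>UNIV. (x $ i) ^ (axis j 1 $ i)) = x $ j"
        by (subst prod.mono_neutral_right[of _ "{j}"]) (auto simp: axis_def)
      then show ?thesis
        by (simp add: power_add prod.distrib)
    qed
    have shift: "c' (\<alpha> + axis j 1) = c \<alpha>" for \<alpha>
    proof -
      have "\<alpha> + axis j 1 - axis j 1 = \<alpha>"
        by (simp add: vec_eq_iff)
      then show ?thesis
        by (simp add: c'_def axis_def)
    qed
    have "(\<Sum>\<beta>\<in>simplex_points (Suc m). c' \<beta> * (\<Prod>i\<in>UNIV. (x $ i) ^ (\<beta> $ i)))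
        = (\<Sum>\<beta>\<in>{\<beta> \<in> simplex_points (Suc m). \<beta> $ j > 0}. c' \<beta> * (\<Prod>i\<in>UNIV. (x $ i) ^ (\<beta> $ i)))"
      by (rule sum.mono_neutral_right) (auto simp: finite_simplex_points c'_def)
    also have "\<dots> = (\<Sum>\<alpha>\<in>simplex_points m. c' (\<alpha> + axis j 1)
        * (\<Prod>i\<in>UNIV. (x $ i) ^ ((\<alpha> + axis j 1) $ i)))"
      by (rule sum_simplex_points_shift)
    also have "\<dots> = x $ j * p x"
      unfolding monom shift c by (simp add: sum_distrib_left mult.left_commute)
    finally show ?thesis ..
  qed
  then show ?thesis
    unfolding poly_degree_le_def by blast
qed

lemma poly_degree_le_pochhammer_subset_sum:
  "poly_degree_le k (\<lambda>x. pochhammer (- subset_sum J x) k)"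
proof (induction k)
  case 0
  then show ?case by (simp add: poly_degree_le_const)
next
  case (Suc k)
  have expand: "pochhammer (- subset_sum J x) (Suc k)
      = - 1 * (\<Sum>j\<in>J. x $ j * pochhammer (- subset_sum J x) k)
        + real k * pochhammer (- subset_sum J x) k" for x
    by (simp add: pochhammer_Suc sum_distrib_right[symmetric] subset_sum_def[symmetric]
        algebra_simps)
  show ?case
    unfolding expand
    by (intro poly_degree_le_add poly_degree_le_scale poly_degree_le_sum
        poly_degree_le_mult_coord Suc poly_degree_le_mono[OF Suc]) simp
qed

text \<open>
  Some monomial of degree exactly \<open>m\<close> occurs: otherwise the restriction to the axis of a
  \<open>j \<in> J\<close> would have degree below \<open>m\<close>, but this restriction is the univariate Hahn polynomial.
\<close>

lemma polynomial_of_degree_hahn_subset: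
  fixes a :: "real ^ 'n::finite"
  assumes "J \<noteq> {}" "m \<le> N" "\<And>i. a $ i > 0" "b > 0"
  shows "polynomial_of_degree m (hahn_subset N a b m J)"
proof -
  let ?\<alpha> = "subset_sum J a" and ?\<beta> = "coord_sum a + b - subset_sum J a"
  have pos: "?\<alpha> > 0" "?\<alpha> + ?\<beta> > 0"
    using subset_sum_pos[of J a] subset_sum_pos[of UNIV a] assms by auto
  have "poly_degree_le m (\<lambda>x. \<Sum>k\<le>m. hahn_coeff m ?\<alpha> ?\<beta> N k * pochhammer (- subset_sum J x) k)"
    by (intro poly_degree_le_sum poly_degree_le_scale
        poly_degree_le_mono[OF poly_degree_le_pochhammer_subset_sum]) auto
  then obtain c where c: "\<And>x. hahn_subset N a b m J x
      = (\<Sum>\<alpha>\<in>simplex_points m. c \<alpha> * (\<Prod>i\<in>UNIV. (x $ i) ^ (\<alpha> $ i)))"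
    unfolding poly_degree_le_def hahn_subset_def hahn_eq_sum_coeff by blast
  define d where "d \<alpha> = (if \<alpha> \<in> simplex_points m then c \<alpha> else 0)" for \<alpha>
  have supp: "{\<alpha>. d \<alpha> \<noteq> 0} \<subseteq> simplex_points m"
    by (auto simp: d_def split: if_splits)
  have top: "\<exists>\<alpha>. d \<alpha> \<noteq> 0 \<and> total \<alpha> = m"
  proof (rule ccontr)
    assume no_top: "\<not> ?thesis"
    obtain j where j: "j \<in> J" using assms(1) by blast
    obtain Q where Q: "degree Q = m" "\<And>t. poly Q t = hahn m t ?\<alpha> ?\<beta> N"
      using hahn_poly_exists[OF assms(2) pos] by metis
    (* R is the restriction of the expansion to the j-th axis, with the top degree omitted *)
    define R where "R = (\<Sum>\<alpha>\<in>simplex_points m. if total \<alpha> = m then 0 else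
      smult (c \<alpha>) (\<Prod>i\<in>UNIV. (if i = j then [:0, 1:] else 0) ^ (\<alpha> $ i)) :: real poly)"
    have c_top: "c \<alpha> = 0" if "\<alpha> \<in> simplex_points m" "total \<alpha> = m" for \<alpha>
      using no_top that by (metis d_def)
    have "poly Q t = poly R t" for t
    proof -
      have "poly Q t = hahn_subset N a b m J (axis j t)"
        using j by (simp add: Q hahn_subset_def)
      also have "\<dots> = poly R t"
        unfolding c R_def poly_sum
      proof (rule sum.cong)
        fix \<alpha> :: "nat ^ 'n"
        assume \<alpha>: "\<alpha> \<in> simplex_points m"
        have "axis j t $ i = poly (if i = j then [:0, 1:] else 0) t" for i
          by (simp add: axis_def)
        then show "c \<alpha> * (\<Prod>i\<in>UNIV. (axis j t $ i) ^ (\<alpha> $ i))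
            = poly (if total \<alpha> = m then 0 else
                smult (c \<alpha>) (\<Prod>i\<in>UNIV. (if i = j then [:0, 1:] else 0) ^ (\<alpha> $ i))) t"
          using c_top[OF \<alpha>] by (cases "total \<alpha> = m") (simp_all add: poly_prod)
      qed simp
      finally show ?thesis .
    qed
    then have "Q = R"
      by (simp add: poly_eq_poly_eq_iff[symmetric] ext)
    have deg_monom: "degree (\<Prod>i\<in>UNIV. (if i = j then [:0, 1 :: real:] else 0) ^ (\<alpha> $ i)) \<le> total \<alpha>"
      for \<alpha> :: "nat ^ 'n"
    proof -
      have "degree (\<Prod>i\<in>UNIV. (if i = j then [:0, 1 :: real:] else 0) ^ (\<alpha> $ i))
          \<le> (\<Sum>i\<in>UNIV. degree ((if i = j then [:0, 1 :: real:] else 0) ^ (\<alpha> $ i)))"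
        using degree_prod_sum_le[of UNIV "\<lambda>i. (if i = j then [:0, 1 :: real:] else 0) ^ (\<alpha> $ i)"]
        by (simp add: o_def)
      also have "\<dots> \<le> total \<alpha>"
        by (intro sum_mono order.trans[OF degree_power_le]) auto
      finally show ?thesis .
    qed
    have "m > 0"
    proof (rule ccontr)
      assume "\<not> m > 0"
      then have "Q = 0"
        unfolding \<open>Q = R\<close> R_def by (intro sum.neutral) (auto simp: mem_simplex_points)
      then show False
        using Q(2)[of 0] by simp
    qed
    have "degree R \<le> m - 1"
      unfolding R_def
    proof (intro degree_sum_le finite_simplex_points)
      fix \<alpha> :: "nat ^ 'n"
      assume "\<alpha> \<in> simplex_points m"
      then show "degree (if total \<alpha> = m then 0 else
          smult (c \<alpha>) (\<Prod>i\<in>UNIV. (if i = j then [:0, 1:] else 0) ^ (\<alpha> $ i))) \<le> m - 1"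
        using deg_monom[of \<alpha>] by (auto simp: mem_simplex_points)
    qed
    then show False
      using Q(1) \<open>Q = R\<close> \<open>m > 0\<close> by simp
  qed
  have "hahn_subset N a b m J
      = (\<lambda>x. \<Sum>\<alpha>\<in>{\<alpha>. d \<alpha> \<noteq> 0}. d \<alpha> * (\<Prod>i\<in>UNIV. (x $ i) ^ (\<alpha> $ i)))"
    unfolding c using supp
    by (intro ext sum.mono_neutral_cong_right) (auto simp: finite_simplex_points d_def)
  moreover have "finite {\<alpha>. d \<alpha> \<noteq> 0}"
    using supp finite_simplex_points by (rule finite_subset)
  moreover have "\<forall>\<alpha>. d \<alpha> \<noteq> 0 \<longrightarrow> total \<alpha> \<le> m"
    using supp by (auto simp: mem_simplex_points)
  ultimately show ?thesis
    unfolding polynomial_of_degree_def using top by blast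
qed

lemma hahn_subset_0 [simp]: "hahn_subset N a b m J 0 = 1"
  by (simp add: hahn_subset_def)

text \<open>
  Along the axis of an index that belongs to only one of the two sets, one of the polynomials is
  constant and the other is not.
\<close>

lemma hahn_subset_inj:
  fixes a :: "real ^ 'n::finite"
  assumes "1 \<le> m" "m \<le> N" "\<And>i. a $ i > 0" "b > 0"
    and eq: "hahn_subset N a b m J = hahn_subset N a b m J'"
  shows "J = J'"
proof -
  have sub: "K \<subseteq> K'" if eq: "hahn_subset N a b m K = hahn_subset N a b m K'" for K K'
  proof (rule subsetI, rule ccontr)
    fix j assume j: "j \<in> K" "j \<notin> K'"
    have "hahn m t (subset_sum K a) (coord_sum a + b - subset_sum K a) N = 1" for t
      using fun_cong[OF eq, of "axis j t"] j by (simp add: hahn_subset_def)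
    moreover have "subset_sum K a > 0" "coord_sum a + b > 0"
      using subset_sum_pos[of K a] subset_sum_pos[of UNIV a] j assms by auto
    ultimately show False
      using hahn_not_constant[of m N "subset_sum K a" "coord_sum a + b - subset_sum K a"] assms
      by simp
  qed
  show ?thesis
    using sub[OF eq] sub[OF eq[symmetric]] by blast
qed

section \<open>Self-adjointness\<close>

lemma weight_pos:
  assumes "\<And>i. a $ i > 0" "b > 0"
  shows "weight N a b x > 0"
  using subset_sum_pos[of UNIV a] assms
  unfolding weight_def by (auto intro!: divide_pos_pos mult_pos_pos prod_pos pochhammer_pos)

text \<open>
  With the reservoir \<open>N - |z|\<close> regarded as one more coordinate with parameter \<open>b\<close>, the weight
  is, up to a constant, a product of factors \<open>(a\<^sub>i)\<^sub>k / k!\<close>, each of which grows by \<open>(a\<^sub>i + k) / (k + 1)\<close> when \<open>k\<close>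
  increases by one. Moving a unit from the reservoir to coordinate \<open>j\<close> changes two factors.
\<close>

lemma detailed_balance:
  fixes z :: "nat ^ 'n::finite"
  assumes "total z < N"
  shows "weight N a b (z + axis j 1) * (real (z $ j) + 1) * (real N - real (total z) - 1 + b)
    = weight N a b z * (real N - real (total z)) * (real (z $ j) + a $ j)"
proof -
  define r where "r = N - Suc (total z)"
  have r: "N - total z = Suc r" "N - total (z + axis j 1) = r"
    "real N - real (total z) = real r + 1"
    using assms unfolding total_add_axis by (auto simp: r_def)
  define F where "F = (\<Prod>i\<in>UNIV - {j}. fact (z $ i) :: real)"
  define P where "P = (\<Prod>i\<in>UNIV - {j}. pochhammer (a $ i) (z $ i))"
  have split: "prod f UNIV = f j * prod f (UNIV - {j})" for f :: "'n \<Rightarrow> real"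
    by (simp add: prod.remove)
  have F0: "(\<Prod>i\<in>UNIV. fact (z $ i)) = fact (z $ j) * F"
    unfolding split F_def ..
  have P0: "(\<Prod>i\<in>UNIV. pochhammer (a $ i) (z $ i)) = pochhammer (a $ j) (z $ j) * P"
    unfolding split P_def ..
  have F1: "(\<Prod>i\<in>UNIV. fact ((z + axis j 1) $ i)) = (real (z $ j) + 1) * fact (z $ j) * F"
    unfolding split F_def by (auto simp: axis_def intro!: prod.cong)
  have P1: "(\<Prod>i\<in>UNIV. pochhammer (a $ i) ((z + axis j 1) $ i))
      = pochhammer (a $ j) (z $ j) * (a $ j + real (z $ j)) * P"
    unfolding split P_def by (auto simp: axis_def pochhammer_Suc intro!: prod.cong)
  have nz: "F \<noteq> 0" "real (z $ j) + 1 \<noteq> 0" "real r + 1 \<noteq> 0"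
    by (auto simp: F_def)
  show ?thesis
    unfolding weight_def r F0 P0 F1 P1
    using nz by (simp add: pochhammer_Suc divide_simps) (simp add: algebra_simps)
qed

lemma sum_simplex_points_shift_weighted:
  fixes F :: "nat ^ 'n::finite \<Rightarrow> real"
  shows "(\<Sum>x\<in>simplex_points (Suc M). real (x $ j) * F x)
    = (\<Sum>z\<in>simplex_points M. (real (z $ j) + 1) * F (z + axis j 1))"
proof -
  have "(\<Sum>x\<in>simplex_points (Suc M). real (x $ j) * F x)
      = (\<Sum>x\<in>{x \<in> simplex_points (Suc M). x $ j > 0}. real (x $ j) * F x)"
    by (rule sum.mono_neutral_right) (auto simp: finite_simplex_points)
  also have "\<dots> = (\<Sum>z\<in>simplex_points M. real ((z + axis j 1) $ j) * F (z + axis j 1))"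
    by (rule sum_simplex_points_shift)
  also have "\<dots> = (\<Sum>z\<in>simplex_points M. (real (z $ j) + 1) * F (z + axis j 1))"
    by (simp add: axis_def add.commute)
  finally show ?thesis .
qed

text \<open>
  A move takes one unit from one place to another. Its two end points arise from the same
  configuration \<open>z\<close> of \<open>N - 1\<close> units by adding one unit, either to a coordinate or to the
  reservoir; the latter is \<open>z\<close> itself read as a point of the simplex of size \<open>N\<close>. By detailed
  balance the edge weight serves all end points at once: the weight of an end point times its
  number of units in the place that received the unit is the edge weight times the sum of that
  place's count in \<open>z\<close> and its parameter.
\<close>

definition edge_weight :: "nat \<Rightarrow> real ^ 'n::finite \<Rightarrow> real \<Rightarrow> nat ^ 'n \<Rightarrow> real" where
  "edge_weight N a b z =
     weight N a b z * (real N - real (total z)) / (real N - real (total z) - 1 + b)"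

text \<open>
  The sum runs over all pairs of places to which a unit can be added to \<open>z\<close>: the first inner sum
  pairs the reservoir with a coordinate, the second one pairs two coordinates, each unordered
  pair being counted twice.
\<close>

definition dirichlet_form ::
  "nat \<Rightarrow> real ^ 'n::finite \<Rightarrow> real \<Rightarrow> (real ^ 'n \<Rightarrow> real) \<Rightarrow> (real ^ 'n \<Rightarrow> real) \<Rightarrow> real" where
  "dirichlet_form N a b p q =
     (\<Sum>z\<in>simplex_points (N - 1). edge_weight N a b z *
        ((\<Sum>j\<in>UNIV. (real N - real (total z) - 1 + b) * (real (z $ j) + a $ j)
            * (p (real_point z + axis j 1) - p (real_point z))
            * (q (real_point z + axis j 1) - q (real_point z)))
       + (\<Sum>j\<in>UNIV. \<Sum>k\<in>UNIV. (real (z $ j) + a $ j) * (real (z $ k) + a $ k)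
            * (p (real_point z + axis j 1) - p (real_point z + axis k 1))
            * (q (real_point z + axis j 1) - q (real_point z + axis k 1))) / 2))"

lemma dirichlet_form_commute: "dirichlet_form N a b p q = dirichlet_form N a b q p"
  unfolding dirichlet_form_def by (simp add: mult.commute mult.left_commute)

lemma sum_symmetrize:
  fixes y P Q :: "'n::finite \<Rightarrow> real"
  shows "(\<Sum>j\<in>UNIV. \<Sum>k\<in>UNIV. y j * y k * (P j - P k) * Q j)
    = (\<Sum>j\<in>UNIV. \<Sum>k\<in>UNIV. y j * y k * (P j - P k) * (Q j - Q k)) / 2"
proof -
  let ?f = "\<lambda>j k. y j * y k * (P j - P k) * Q j"
  have "(\<Sum>j\<in>UNIV. \<Sum>k\<in>UNIV. y j * y k * (P j - P k) * (Q j - Q k))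
      = (\<Sum>j\<in>UNIV. \<Sum>k\<in>UNIV. ?f j k) + (\<Sum>j\<in>UNIV. \<Sum>k\<in>UNIV. ?f k j)"
    unfolding sum.distrib[symmetric] by (intro sum.cong) (auto simp: algebra_simps)
  also have "(\<Sum>j\<in>UNIV. \<Sum>k\<in>UNIV. ?f k j) = (\<Sum>j\<in>UNIV. \<Sum>k\<in>UNIV. ?f j k)"
    by (rule sum.swap)
  finally show ?thesis by simp
qed

text \<open>
  The three sums of the operator are rewritten as sums over the smaller simplex. There the
  first two combine into products of differences directly, and the third one does so after
  averaging over the two orders of the pair of coordinates.
\<close>

theorem inner_W_H_op:
  fixes a :: "real ^ 'n::finite"
  assumes "N > 0" "b > 0"
  shows "inner_W N a b (H_op N a b p) q = dirichlet_form N a b p q"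
proof -
  obtain M where N: "N = Suc M" using assms(1) gr0_conv_Suc by blast
  let ?S = "simplex_points N :: (nat ^ 'n) set" and ?T = "simplex_points M :: (nat ^ 'n) set"
  let ?w = "weight N a b"
  define u where "u = edge_weight N a b"
  define n where "n z = real N - real (total z)" for z :: "nat ^ 'n"
  define \<beta> where "\<beta> z = n z - 1 + b" for z :: "nat ^ 'n"
  define y where "y z j = real (z $ j) + a $ j" for z :: "nat ^ 'n" and j
  define P where "P z = p (real_point z)" for z
  define Q where "Q z = q (real_point z)" for z
  have \<beta>_pos: "\<beta> z > 0" if "z \<in> ?T" for z
  proof -
    have "real (total z) \<le> real M"
      using that by (simp only: mem_simplex_points of_nat_le_iff)
    then show ?thesis
      using assms(2) unfolding \<beta>_def n_def N of_nat_Suc by linarith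
  qed
  have stay: "?w z * n z = u z * \<beta> z" if "z \<in> ?T" for z
    using \<beta>_pos[OF that] unfolding u_def edge_weight_def \<beta>_def n_def by simp
  have leave: "(real (z $ j) + 1) * ?w (z + axis j 1) = u z * y z j" if "z \<in> ?T" for z j
  proof -
    have "?w (z + axis j 1) * (real (z $ j) + 1) * \<beta> z = u z * y z j * \<beta> z"
      using detailed_balance[of z N a b j] that stay[OF that]
      unfolding \<beta>_def n_def y_def by (simp add: N mem_simplex_points mult_ac)
    then show ?thesis
      using \<beta>_pos[OF that] by (simp add: mult.commute)
  qed
  have n_shift: "n (z + axis j 1) = n z - 1" for z j
    unfolding n_def total_add_axis by simp
  have up: "p (real_point z + axis j 1) = P (z + axis j 1)"
    "q (real_point z + axis j 1) = Q (z + axis j 1)" for z j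
    by (simp_all only: P_def Q_def real_point_add_axis)
  have H: "H_op N a b p (real_point x)
      = (\<Sum>j\<in>UNIV. n x * y x j * (P x - P (x + axis j 1)))
      + (\<Sum>j\<in>UNIV. real (x $ j) * ((n x + b) * (P x - p (real_point x - axis j 1))))
      + (\<Sum>j\<in>UNIV. real (x $ j) * (\<Sum>k\<in>UNIV - {j}. y x k
            * (P x - p (real_point x - axis j 1 + axis k 1))))" for x
    unfolding H_op_def coord_sum_real_point up n_def[symmetric] P_def[symmetric]
    by (simp add: y_def sum_distrib_left mult_ac)
  (* the moves from the reservoir: their rate vanishes on the outer face of the simplex *)
  have births: "(\<Sum>x\<in>?S. (\<Sum>j\<in>UNIV. n x * y x j * (P x - P (x + axis j 1))) * Q x * ?w x)
      = (\<Sum>z\<in>?T. u z * (\<Sum>j\<in>UNIV. \<beta> z * y z j * (P z - P (z + axis j 1)) * Q z))"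
  proof (rule sum.mono_neutral_cong_right)
    show "?T \<subseteq> ?S"
      by (auto simp: N mem_simplex_points)
    show "\<forall>x\<in>?S - ?T. (\<Sum>j\<in>UNIV. n x * y x j * (P x - P (x + axis j 1))) * Q x * ?w x = 0"
    proof
      fix x assume "x \<in> ?S - ?T"
      then have "total x = N"
        by (auto simp: N mem_simplex_points)
      then have "n x = 0"
        by (simp only: n_def diff_self)
      then show "(\<Sum>j\<in>UNIV. n x * y x j * (P x - P (x + axis j 1))) * Q x * ?w x = 0"
        by simp
    qed
    fix z assume "z \<in> ?T"
    have "(\<Sum>j\<in>UNIV. n z * y z j * (P z - P (z + axis j 1))) * Q z * ?w z
        = (?w z * n z) * (\<Sum>j\<in>UNIV. y z j * (P z - P (z + axis j 1)) * Q z)"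
      by (simp add: sum_distrib_left sum_distrib_right mult_ac)
    then show "(\<Sum>j\<in>UNIV. n z * y z j * (P z - P (z + axis j 1))) * Q z * ?w z
        = u z * (\<Sum>j\<in>UNIV. \<beta> z * y z j * (P z - P (z + axis j 1)) * Q z)"
      unfolding stay[OF \<open>z \<in> ?T\<close>] by (simp add: sum_distrib_left mult_ac)
  qed (rule finite_simplex_points)
  have shifted: "(\<Sum>x\<in>?S. (\<Sum>j\<in>UNIV. real (x $ j) * F x j) * Q x * ?w x)
      = (\<Sum>z\<in>?T. u z * (\<Sum>j\<in>UNIV. y z j * F (z + axis j 1) j * Q (z + axis j 1)))"
    for F :: "nat ^ 'n \<Rightarrow> 'n \<Rightarrow> real"
  proof -
    have "(\<Sum>x\<in>?S. (\<Sum>j\<in>UNIV. real (x $ j) * F x j) * Q x * ?w x)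
        = (\<Sum>j\<in>UNIV. \<Sum>x\<in>?S. real (x $ j) * (F x j * Q x * ?w x))"
      by (subst sum.swap) (simp add: sum_distrib_left sum_distrib_right mult_ac)
    also have "\<dots> = (\<Sum>j\<in>UNIV. \<Sum>z\<in>?T. (real (z $ j) + 1)
        * (F (z + axis j 1) j * Q (z + axis j 1) * ?w (z + axis j 1)))"
      unfolding N sum_simplex_points_shift_weighted ..
    also have "\<dots> = (\<Sum>j\<in>UNIV. \<Sum>z\<in>?T. ((real (z $ j) + 1) * ?w (z + axis j 1))
        * (F (z + axis j 1) j * Q (z + axis j 1)))"
      by (simp only: mult_ac)
    also have "\<dots> = (\<Sum>j\<in>UNIV. \<Sum>z\<in>?T. u z * y z j * (F (z + axis j 1) j * Q (z + axis j 1)))"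
      by (simp only: leave cong: sum.cong)
    also have "\<dots> = (\<Sum>z\<in>?T. u z * (\<Sum>j\<in>UNIV. y z j * F (z + axis j 1) j * Q (z + axis j 1)))"
      by (subst sum.swap) (simp add: sum_distrib_left mult_ac)
    finally show ?thesis .
  qed
  have lower: "real_point (z + axis j 1) - axis j 1 = real_point z" for z :: "nat ^ 'n" and j
    unfolding real_point_add_axis by simp
  (* the diagonal term k = j may be included, since its difference is zero *)
  have exchange: "(\<Sum>k\<in>UNIV - {j}. y (z + axis j 1) k * (P (z + axis j 1) - P (z + axis k 1)))
      = (\<Sum>k\<in>UNIV. y z k * (P (z + axis j 1) - P (z + axis k 1)))" for z j
    by (rule sum.mono_neutral_cong_left) (auto simp: y_def axis_def)
  have "inner_W N a b (H_op N a b p) q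
      = (\<Sum>z\<in>?T. u z * (\<Sum>j\<in>UNIV. \<beta> z * y z j * (P z - P (z + axis j 1)) * Q z))
      + (\<Sum>z\<in>?T. u z * (\<Sum>j\<in>UNIV. y z j * (\<beta> z * (P (z + axis j 1) - P z)) * Q (z + axis j 1)))
      + (\<Sum>z\<in>?T. u z * (\<Sum>j\<in>UNIV. y z j
            * (\<Sum>k\<in>UNIV. y z k * (P (z + axis j 1) - P (z + axis k 1))) * Q (z + axis j 1)))"
    unfolding inner_W_def H Q_def[symmetric] distrib_right sum.distrib births shifted n_shift
      lower P_def[symmetric] up exchange \<beta>_def ..
  also have "\<dots> = (\<Sum>z\<in>?T. u z *
      ((\<Sum>j\<in>UNIV. \<beta> z * y z j * (P (z + axis j 1) - P z) * (Q (z + axis j 1) - Q z))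
      + (\<Sum>j\<in>UNIV. \<Sum>k\<in>UNIV. y z j * y z k
            * (P (z + axis j 1) - P (z + axis k 1)) * Q (z + axis j 1))))"
    unfolding sum.distrib[symmetric] distrib_left[symmetric]
    by (intro sum.cong arg_cong2[where f = "(*)"] arg_cong2[where f = "(+)"] refl)
       (auto simp: sum_distrib_left sum_distrib_right sum.distrib[symmetric] algebra_simps
         intro!: sum.cong)
  also have "\<dots> = dirichlet_form N a b p q"
    unfolding sum_symmetrize dirichlet_form_def u_def \<beta>_def n_def y_def up P_def[symmetric]
      Q_def[symmetric] by (simp add: N)
  finally show ?thesis .
qed

lemma inner_W_commute: "inner_W N a b p q = inner_W N a b q p"
  unfolding inner_W_def by (simp add: mult.commute mult.left_commute)

lemma H_op_self_adjoint:
  fixes a :: "real ^ 'n::finite"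
  assumes "N > 0" "b > 0"
  shows "inner_W N a b (H_op N a b p) q = inner_W N a b p (H_op N a b q)"
  using inner_W_H_op[OF assms] dirichlet_form_commute inner_W_commute by metis

lemma inner_W_scale:
  "inner_W N a b (\<lambda>x. c * p x) q = c * inner_W N a b p q"
  unfolding inner_W_def by (simp add: sum_distrib_left mult_ac)

lemma inner_W_scale_right:
  "inner_W N a b p (\<lambda>x. c * q x) = c * inner_W N a b p q"
  unfolding inner_W_def by (simp add: sum_distrib_left mult_ac)

lemma inner_W_add_right:
  "inner_W N a b p (\<lambda>x. q x + r x) = inner_W N a b p q + inner_W N a b p r"
  unfolding inner_W_def by (simp add: sum.distrib[symmetric] algebra_simps)

lemma eigenfunctions_orthogonal:
  fixes a :: "real ^ 'n::finite"
  assumes "N > 0" "b > 0"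
    and "\<And>x. H_op N a b p x = l * p x" "\<And>x. H_op N a b q x = l' * q x" "l \<noteq> l'"
  shows "inner_W N a b p q = 0"
proof -
  have "H_op N a b p = (\<lambda>x. l * p x)" "H_op N a b q = (\<lambda>x. l' * q x)"
    using assms by auto
  then have "l * inner_W N a b p q = l' * inner_W N a b p q"
    using H_op_self_adjoint[OF assms(1,2), of a p q]
    by (simp add: inner_W_scale inner_W_scale_right)
  then show ?thesis using \<open>l \<noteq> l'\<close> by simp
qed

section \<open>Non-orthogonality in the same degree\<close>

definition level :: "real \<Rightarrow> real ^ 'n::finite \<Rightarrow> real" where
  "level s x = of_bool (coord_sum x = s)"

text \<open>
  By reduction to the univariate operator, the operator maps the indicator of a level of \<open>|x|\<close>
  to a combination of the indicators of that level and of its two neighbours.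
\<close>

lemma H_op_level:
  fixes a x :: "real ^ 'n::finite"
  shows "H_op N a b (level s) x
    = ((real N - s) * (s + coord_sum a) + s * (real N - s + b)) * level s x
      + (- ((real N - (s - 1)) * (s - 1 + coord_sum a)) * level (s - 1) x
         + - ((s + 1) * (real N - (s + 1) + b)) * level (s + 1) x)"
proof -
  have "level s = (\<lambda>x :: real ^ 'n. of_bool (coord_sum x = s))"
    by (rule ext) (simp add: level_def)
  then have "H_op N a b (level s) x
      = hahn_op (real N) (coord_sum a) b (\<lambda>t. of_bool (t = s)) (coord_sum x)"
    using H_op_subset_sum[of N a b "\<lambda>t. of_bool (t = s)" UNIV x] by simp
  also have "\<dots> = ((real N - s) * (s + coord_sum a) + s * (real N - s + b)) * level s x
      + (- ((real N - (s - 1)) * (s - 1 + coord_sum a)) * level (s - 1) x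
         + - ((s + 1) * (real N - (s + 1) + b)) * level (s + 1) x)"
    unfolding hahn_op_def level_def by (auto simp: algebra_simps)
  finally show ?thesis .
qed

text \<open>
  Pairing the eigenvalue equation with the indicator of level \<open>s\<close> and moving the operator to the
  indicator gives a three-term recurrence in \<open>s\<close> for the masses of an eigenfunction on the levels.
  Level 0 is the origin alone, level \<open>-1\<close> is empty, and the coefficient of level \<open>s + 1\<close> is
  positive for \<open>s < N\<close>. Hence the masses are determined by the value at the origin.
\<close>

lemma eigenfunctions_agree_on_levels:
  fixes a :: "real ^ 'n::finite"
  assumes "N > 0" "b > 0"
    and p: "\<And>x. H_op N a b p x = l * p x" and q: "\<And>x. H_op N a b q x = l * q x"
    and origin: "p 0 = q 0" and "s \<le> N"
  shows "inner_W N a b p (level (real s)) = inner_W N a b q (level (real s))"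
proof -
  define D where "D r = inner_W N a b p (level r) - inner_W N a b q (level r)" for r
  define down where "down r = (real N - (r - 1)) * (r - 1 + coord_sum a)" for r
  define up where "up r = (r + 1) * (real N - (r + 1) + b)" for r
  define diag where "diag r = (real N - r) * (r + coord_sum a) + r * (real N - r + b)" for r
  have rec: "l * D r = diag r * D r - down r * D (r - 1) - up r * D (r + 1)" for r
  proof -
    have "l * inner_W N a b f (level r) = diag r * inner_W N a b f (level r)
        - down r * inner_W N a b f (level (r - 1)) - up r * inner_W N a b f (level (r + 1))"
      if "\<And>x. H_op N a b f x = l * f x" for f
    proof -
      have lhs: "H_op N a b f = (\<lambda>x. l * f x)"
        using that by auto
      have rhs: "H_op N a b (level r) = (\<lambda>x. diag r * level r x
          + (- down r * level (r - 1) x + - up r * level (r + 1) x))"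
        unfolding diag_def down_def up_def by (rule ext) (rule H_op_level)
      show ?thesis
        using H_op_self_adjoint[OF assms(1,2), of a f "level r"]
        unfolding lhs rhs inner_W_scale inner_W_scale_right inner_W_add_right by simp
    qed
    from this[OF p] this[OF q] show ?thesis
      unfolding D_def by (simp add: algebra_simps)
  qed
  have "D (real s) = 0 \<and> D (real s - 1) = 0"
    using \<open>s \<le> N\<close>
  proof (induction s)
    case 0
    have "real k \<noteq> - 1" for k :: nat
      using of_nat_0_le_iff[of k, where ?'a = real] by linarith
    then have "inner_W N a b f (level (- 1)) = 0" for f
      unfolding inner_W_def level_def coord_sum_real_point by (simp del: of_nat_sum)
    moreover have "inner_W N a b p (level 0) = inner_W N a b q (level 0)"
      unfolding inner_W_def
    proof (rule sum.cong)
      fix z :: "nat ^ 'n"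
      have "real_point z = 0" if "total z = 0"
        using that by (simp add: vec_eq_iff)
      then show "p (real_point z) * level 0 (real_point z) * weight N a b z
          = q (real_point z) * level 0 (real_point z) * weight N a b z"
        using origin unfolding level_def coord_sum_real_point
        by (cases "total z = 0") (simp_all del: of_nat_sum sum_eq_0_iff)
    qed simp
    ultimately show ?case
      by (simp add: D_def)
  next
    case (Suc s)
    then have "up (real s) * D (real s + 1) = 0"
      using rec[of "real s"] by simp
    moreover have "up (real s) > 0"
      unfolding up_def using Suc.prems \<open>b > 0\<close> by (intro mult_pos_pos) auto
    ultimately show ?case
      using Suc by (simp add: add.commute)
  qed
  then show ?thesis
    by (simp add: D_def)
qed

lemma inner_W_radial:
  fixes p :: "real ^ 'n::finite \<Rightarrow> real"
  shows "inner_W N a b p (\<lambda>x. g (coord_sum x)) = (\<Sum>s\<le>N. g (real s) * inner_W N a b p (level (real s)))"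
proof -
  have "(\<Sum>s\<le>N. g (real s) * level (real s) (real_point z)) = g (coord_sum (real_point z))"
    if "z \<in> simplex_points N" for z :: "nat ^ 'n"
  proof -
    have "(\<Sum>s\<le>N. g (real s) * level (real s) (real_point z)) = (\<Sum>s\<in>{total z}. g (real s))"
      using that unfolding level_def coord_sum_real_point
      by (intro sum.mono_neutral_cong_right) (auto simp: mem_simplex_points simp del: of_nat_sum)
    then show ?thesis
      by (simp add: coord_sum_real_point)
  qed
  then have "inner_W N a b p (\<lambda>x. g (coord_sum x)) = (\<Sum>z\<in>simplex_points N.
      p (real_point z) * (\<Sum>s\<le>N. g (real s) * level (real s) (real_point z)) * weight N a b z)"
    unfolding inner_W_def by (intro sum.cong) auto
  also have "\<dots> = (\<Sum>s\<le>N. g (real s) * inner_W N a b p (level (real s)))"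
    unfolding inner_W_def sum_distrib_left sum_distrib_right
    by (subst sum.swap) (simp add: mult_ac)
  finally show ?thesis .
qed

lemma inner_W_self_pos:
  fixes a :: "real ^ 'n::finite"
  assumes "\<And>i. a $ i > 0" "b > 0" "p 0 \<noteq> 0"
  shows "inner_W N a b p p > 0"
  unfolding inner_W_def
proof (rule sum_pos2[where i = 0])
  have "real_point 0 = (0 :: real ^ 'n)"
    by (simp add: vec_eq_iff)
  then show "0 < p (real_point 0) * p (real_point 0) * weight N a b 0"
    using assms by (auto simp: weight_pos zero_less_mult_iff linorder_neq_iff)
  show "0 \<le> p (real_point z) * p (real_point z) * weight N a b z" for z
    using weight_pos[of a b N z] assms by (simp add: less_imp_le)
qed (auto simp: finite_simplex_points mem_simplex_points)

lemma inner_W_hahn_subset_total_pos: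
  fixes a :: "real ^ 'n::finite"
  assumes "N > 0" "m \<le> N" "\<And>i. a $ i > 0" "b > 0" "J \<noteq> {}"
  shows "inner_W N a b (hahn_subset N a b m J) (hahn_subset N a b m UNIV) > 0"
proof -
  have "hahn_subset N a b m UNIV = (\<lambda>x. hahn m (coord_sum x) (coord_sum a) b N)"
    by (rule ext) (simp add: hahn_subset_def)
  then have "inner_W N a b (hahn_subset N a b m J) (hahn_subset N a b m UNIV)
      = inner_W N a b (hahn_subset N a b m UNIV) (hahn_subset N a b m UNIV)"
    using eigenfunctions_agree_on_levels[OF assms(1,4)
        H_op_hahn_subset[OF assms(5,2,3)] H_op_hahn_subset[OF UNIV_not_empty assms(2,3)]]
    by (simp add: inner_W_radial[where g = "\<lambda>t. hahn m t (coord_sum a) b N"])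
  also have "\<dots> > 0"
    using assms by (intro inner_W_self_pos) auto
  finally show ?thesis .
qed

theorem proposition3p1:
  fixes N :: nat and a :: "real ^ 'n::finite" and b :: real
  assumes "CARD('n) \<ge> 2" and "N > CARD('n)"
    and "\<And>i. a $ i > 0" and "b > 0"
  shows
    "(\<forall>J m. J \<noteq> {} \<and> m \<le> N \<longrightarrow>
        (\<forall>x. H_op N a b (hahn_subset N a b m J) x
           = real m * (real m + coord_sum a + b - 1) * hahn_subset N a b m J x))
   \<and> (\<forall>m. 1 \<le> m \<and> m \<le> N \<longrightarrow>
        hahn_subset N a b m ` {J. J \<noteq> {}}
          \<subseteq> {p. eigenpolynomial N a b m (real m * (real m + coord_sum a + b - 1)) p}
      \<and> card (hahn_subset N a b m ` {J. J \<noteq> {}}) = 2 ^ CARD('n) - 1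
      \<and> (\<forall>J J'. J \<noteq> {} \<and> J' \<noteq> {} \<and> J \<noteq> J' \<longrightarrow>
           \<not> (\<exists>c. \<forall>x. hahn_subset N a b m J x = c * hahn_subset N a b m J' x)))
   \<and> (\<forall>m m' J J'. m \<le> N \<and> m' \<le> N \<and> m \<noteq> m' \<and> J \<noteq> {} \<and> J' \<noteq> {} \<longrightarrow>
        inner_W N a b (hahn_subset N a b m J) (hahn_subset N a b m' J') = 0)
   \<and> (\<forall>m. 1 \<le> m \<and> m \<le> N \<longrightarrow>
        (\<exists>J J'. J \<noteq> {} \<and> J' \<noteq> {} \<and> J \<noteq> J' \<and>
           inner_W N a b (hahn_subset N a b m J) (hahn_subset N a b m J') \<noteq> 0))"
proof (intro conjI allI impI)
  have "N > 0" using assms(2) by simp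
  note eigen = H_op_hahn_subset[where a = a and b = b and N = N, OF _ _ assms(3)]
  note inj = hahn_subset_inj[where a = a and b = b and N = N, OF _ _ assms(3,4)]
  {
    fix J :: "'n set" and m x
    assume "J \<noteq> {} \<and> m \<le> N"
    then show "H_op N a b (hahn_subset N a b m J) x
        = real m * (real m + coord_sum a + b - 1) * hahn_subset N a b m J x"
      by (intro eigen) auto
  next
    fix m assume "1 \<le> m \<and> m \<le> N"
    then show "hahn_subset N a b m ` {J. J \<noteq> {}}
        \<subseteq> {p. eigenpolynomial N a b m (real m * (real m + coord_sum a + b - 1)) p}"
      using assms by (auto simp: eigenpolynomial_def intro!: eigen polynomial_of_degree_hahn_subset)
  next
    fix m assume m: "1 \<le> m \<and> m \<le> N"
    have "inj_on (hahn_subset N a b m) {J. J \<noteq> {}}"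
      using inj m by (auto intro!: inj_onI)
    moreover have "{J :: 'n set. J \<noteq> {}} = Pow UNIV - {{}}"
      by auto
    ultimately show "card (hahn_subset N a b m ` {J. J \<noteq> {}}) = 2 ^ CARD('n) - 1"
      by (simp add: card_image card_Pow card_Diff_singleton del: Pow_UNIV)
  next
    fix m and J J' :: "'n set"
    assume m: "1 \<le> m \<and> m \<le> N" and J: "J \<noteq> {} \<and> J' \<noteq> {} \<and> J \<noteq> J'"
    show "\<not> (\<exists>c. \<forall>x. hahn_subset N a b m J x = c * hahn_subset N a b m J' x)"
    proof
      assume "\<exists>c. \<forall>x. hahn_subset N a b m J x = c * hahn_subset N a b m J' x"
      then obtain c where c: "\<And>x. hahn_subset N a b m J x = c * hahn_subset N a b m J' x"
        by blast
      from c[of 0] have "c = 1" by simp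
      with c have "hahn_subset N a b m J = hahn_subset N a b m J'" by auto
      with inj m J show False by auto
    qed
  next
    fix m m' and J J' :: "'n set"
    assume *: "m \<le> N \<and> m' \<le> N \<and> m \<noteq> m' \<and> J \<noteq> {} \<and> J' \<noteq> {}"
    define A where "A = coord_sum a + b"
    have "A > 0"
      using subset_sum_pos[of UNIV a] assms by (simp add: A_def)
    have "(real m - real m') * (real m + real m' + A - 1) \<noteq> 0"
      using * \<open>A > 0\<close> by auto
    then have "real m * (real m + coord_sum a + b - 1) \<noteq> real m' * (real m' + coord_sum a + b - 1)"
      unfolding A_def by (simp add: algebra_simps)
    then show "inner_W N a b (hahn_subset N a b m J) (hahn_subset N a b m' J') = 0"
      using * by (intro eigenfunctions_orthogonal[OF \<open>N > 0\<close> assms(4) eigen eigen]) auto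
  next
    fix m assume m: "1 \<le> m \<and> m \<le> N"
    obtain j :: 'n where True by blast
    have "{j} \<noteq> UNIV"
      using assms(1) by (metis card_1_singleton_iff One_nat_def Suc_1 not_less_eq_eq order_refl)
    moreover have "inner_W N a b (hahn_subset N a b m {j}) (hahn_subset N a b m UNIV) \<noteq> 0"
      using inner_W_hahn_subset_total_pos[of N m a b "{j}"] \<open>N > 0\<close> m assms by auto
    ultimately show "\<exists>J J'. J \<noteq> {} \<and> J' \<noteq> {} \<and> J \<noteq> J' \<and>
        inner_W N a b (hahn_subset N a b m J) (hahn_subset N a b m J') \<noteq> 0"
      by (intro exI[of _ "{j}"] exI[of _ UNIV]) auto
  }
qed

end
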